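(* For every integer $n\ge 5$, \begin{align*} (n-1)(n-2)T_{n-1} &=6 \sum_{\substack{k_1+k_2+k_3=n-5\\ k_1,k_2,k_3\ge 0}}T_{k_1}T_{k_2}T_{k_3} +6 \sum_{\substack{k_1+k_2+k_3=n-4\\ k_1,k_2,k_3\ge 0}}T_{k_1}T_{k_2}T_{k_3} +12 \sum_{\substack{k_1+k_2+k_3=n-2\\ k_1,k_2,k_3\ge 0}}T_{k_1}T_{k_2}T_{k_3}\\ &\quad+6 \sum_{\substack{k_1+k_2+k_3=n-1\\ k_1,k_2,k_3\ge 0}}T_{k_1}T_{k_2}T_{k_3} +2 \sum_{\substack{k_1+k_2+k_3=n\\ k_1,k_2,k_3\ge 0}}T_{k_1}T_{k_2}T_{k_3}. \end{align*}
   Context: The Tribonacci numbers $T_n$ are defined by $T_0=0$, $T_1=T_2=1$ and $T_n=T_{n-1}+T_{n-2}+T_{n-3}$ for $n\ge 3$. *)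

theory Defs
  imports Main
begin

fun tribonacci :: "nat \<Rightarrow> nat" where
  "tribonacci 0 = 0"
| "tribonacci (Suc 0) = 1"
| "tribonacci (Suc (Suc 0)) = 1"
| "tribonacci (Suc (Suc (Suc n))) =
     tribonacci (Suc (Suc n)) + tribonacci (Suc n) + tribonacci n"

end

theory Submission
  imports Defs "HOL-Computational_Algebra.Formal_Power_Series"
begin

unbundle fps_syntax

text \<open>
  Let \<open>F = X / D\<close> with \<open>D = 1 - X - X\<^sup>2 - X\<^sup>3\<close> be the generating function of the Tribonacci
  numbers. Differentiating \<open>F D = X\<close> twice gives
  \<open>F'' D\<^sup>3 = - 2 D D' + 2 X D'\<^sup>2 - X D D'' = 2 + 6 X + 12 X\<^sup>2 + 6 X\<^sup>4 + 6 X\<^sup>5\<close>.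
  Multiplying by \<open>F\<^sup>3\<close> turns \<open>D\<^sup>3\<close> into \<open>X\<^sup>3\<close>, and the theorem is the comparison of the
  coefficients of \<open>X\<^sup>n\<close>.
\<close>

definition trib_fps :: "int fps" where
  "trib_fps = Abs_fps (\<lambda>n. int (tribonacci n))"

lemma trib_fps_nth [simp]: "trib_fps $ n = int (tribonacci n)"
  by (simp add: trib_fps_def)

text \<open>Coefficients 0, 1 and 2 come from the initial values, as 0, 1 and 1 - 1 = 0; every later
  one is the recurrence brought to one side.\<close>

lemma trib_fps_times_denominator:
  "trib_fps * (1 - fps_X - fps_X ^ 2 - fps_X ^ 3) = fps_X"
proof (rule fps_ext)
  fix n
  have "(trib_fps * (1 - fps_X - fps_X ^ 2 - fps_X ^ 3)) $ n =
      (trib_fps - fps_X * trib_fps - fps_X ^ 2 * trib_fps - fps_X ^ 3 * trib_fps) $ n"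
    by (simp add: algebra_simps)
  also have "\<dots> = fps_X $ n"
    by (cases n rule: tribonacci.cases)
       (simp_all add: fps_X_power_mult_nth)
  finally show "(trib_fps * (1 - fps_X - fps_X ^ 2 - fps_X ^ 3)) $ n = fps_X $ n" .
qed

lemma trib_fps_second_deriv:
  "fps_X ^ 3 * fps_deriv (fps_deriv trib_fps) =
    (2 + 6 * fps_X + 12 * fps_X ^ 2 + 6 * fps_X ^ 4 + 6 * fps_X ^ 5) * trib_fps ^ 3"
proof -
  define D :: "int fps" where "D = 1 - fps_X - fps_X ^ 2 - fps_X ^ 3"
  define F' where "F' = fps_deriv trib_fps"
  define F'' where "F'' = fps_deriv F'"
  define D' :: "int fps" where "D' = - 1 - 2 * fps_X - 3 * fps_X ^ 2"
  define D'' :: "int fps" where "D'' = - 2 - 6 * fps_X"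
  have dD: "fps_deriv D = D'" and dD': "fps_deriv D' = D''"
    by (simp_all add: D_def D'_def D''_def fps_deriv_power eval_nat_numeral algebra_simps
          flip: numeral_fps_const)
  have FD: "trib_fps * D = fps_X"
    using trib_fps_times_denominator by (simp add: D_def)
  have FD': "trib_fps * D' + F' * D = 1"
    using arg_cong[OF FD, of fps_deriv] by (simp add: dD F'_def)
  have FD'': "trib_fps * D'' + 2 * F' * D' + F'' * D = 0"
    using arg_cong[OF FD', of fps_deriv]
    by (simp add: dD dD' F''_def algebra_simps flip: F'_def)
  have "F'' * D ^ 3 = - 2 * D * D' + 2 * fps_X * D' ^ 2 - fps_X * D * D''"
  proof -
    \<comment> \<open>Elimination of \<open>trib_fps\<close> and \<open>F'\<close>: the second
      product removes \<open>2 * F' * D' * D ^ 2\<close> but introduces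
      \<open>- 2 * trib_fps * D * D' ^ 2\<close>, which the third cancels; the last removes
      \<open>trib_fps * D ^ 2 * D''\<close>.\<close>
    have "F'' * D ^ 3 = D ^ 2 * (trib_fps * D'' + 2 * F' * D' + F'' * D)
        - 2 * D * D' * (trib_fps * D' + F' * D) + 2 * D' ^ 2 * (trib_fps * D)
        - (trib_fps * D) * D * D''"
      by algebra
    then show ?thesis
      unfolding FD FD' FD'' by simp
  qed
  also have "\<dots> = 2 + 6 * fps_X + 12 * fps_X ^ 2 + 6 * fps_X ^ 4 + 6 * fps_X ^ 5"
    unfolding D_def D'_def D''_def by algebra
  finally have "F'' * D ^ 3 * trib_fps ^ 3 =
      (2 + 6 * fps_X + 12 * fps_X ^ 2 + 6 * fps_X ^ 4 + 6 * fps_X ^ 5) * trib_fps ^ 3"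
    by simp
  moreover have "F'' * D ^ 3 * trib_fps ^ 3 = F'' * (trib_fps * D) ^ 3"
    by (simp add: power_mult_distrib ac_simps)
  ultimately show ?thesis
    unfolding FD F''_def F'_def by (metis mult.commute)
qed

lemma fps_cube_nth:
  fixes f :: "'a::comm_semiring_1 fps"
  shows "(f ^ 3) $ n = (\<Sum>(i, j, k) \<in> {(i, j, k). i + j + k = n}. f $ i * f $ j * f $ k)"
proof -
  have "(f ^ 3) $ n = (\<Sum>i=0..n. \<Sum>j=0..n - i. f $ i * f $ j * f $ (n - i - j))"
    by (simp add: power3_eq_cube mult.assoc fps_mult_nth sum_distrib_left)
  also have "\<dots> = (\<Sum>(i, j) \<in> (SIGMA i:{0..n}. {0..n - i}). f $ i * f $ j * f $ (n - i - j))"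
    by (simp add: sum.Sigma)
  \<comment> \<open>A triple with sum \<open>n\<close> is fixed by its first two entries, and
    \<open>i + j \<le> n\<close> keeps \<open>n - i - j\<close> from truncating.\<close>
  also have "\<dots> = (\<Sum>(i, j, k) \<in> {(i, j, k). i + j + k = n}. f $ i * f $ j * f $ k)"
    by (rule sum.reindex_bij_witness[where i = "\<lambda>(i, j, k). (i, j)"
          and j = "\<lambda>(i, j). (i, j, n - i - j)"]) auto
  finally show ?thesis .
qed

theorem theorem1:
  fixes n :: nat
  assumes "n \<ge> 5"
  shows "(n - 1) * (n - 2) * tribonacci (n - 1) =
      6 * (\<Sum>(k1, k2, k3) \<in> {(k1, k2, k3). k1 + k2 + k3 = n - 5}.
             tribonacci k1 * tribonacci k2 * tribonacci k3)
    + 6 * (\<Sum>(k1, k2, k3) \<in> {(k1, k2, k3). k1 + k2 + k3 = n - 4}.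
             tribonacci k1 * tribonacci k2 * tribonacci k3)
    + 12 * (\<Sum>(k1, k2, k3) \<in> {(k1, k2, k3). k1 + k2 + k3 = n - 2}.
             tribonacci k1 * tribonacci k2 * tribonacci k3)
    + 6 * (\<Sum>(k1, k2, k3) \<in> {(k1, k2, k3). k1 + k2 + k3 = n - 1}.
             tribonacci k1 * tribonacci k2 * tribonacci k3)
    + 2 * (\<Sum>(k1, k2, k3) \<in> {(k1, k2, k3). k1 + k2 + k3 = n}.
             tribonacci k1 * tribonacci k2 * tribonacci k3)"
proof -
  define S where "S m = (\<Sum>(k1, k2, k3) \<in> {(k1, k2, k3). k1 + k2 + k3 = m}.
      tribonacci k1 * tribonacci k2 * tribonacci k3)" for m
  have cube: "(trib_fps ^ 3) $ m = int (S m)" for m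
    by (simp add: fps_cube_nth S_def case_prod_unfold)
  obtain m where n: "n = m + 3"
    using assms that[of "n - 3"] by simp
  \<comment> \<open>Coefficient \<open>n - 3\<close> of the second derivative is
    \<open>(n - 2) * (n - 1)\<close> times coefficient \<open>n - 1\<close> of
    \<open>trib_fps\<close>; the factor \<open>fps_X ^ 3\<close> moves it to index
    \<open>n\<close>.\<close>
  have "int ((n - 1) * (n - 2) * tribonacci (n - 1)) =
      (fps_X ^ 3 * fps_deriv (fps_deriv trib_fps)) $ n"
    unfolding fps_X_power_mult_nth fps_deriv_nth by (simp add: n algebra_simps del: tribonacci.simps)
  \<comment> \<open>The form \<open>fps_X ^ k * trib_fps ^ 3\<close>, even for exponent 1, lets a
    single shift rule read off every \<open>S (n - k)\<close> with \<open>k > 0\<close>.\<close>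
  also have "\<dots> = (fps_const 6 * (fps_X ^ 5 * trib_fps ^ 3)
      + fps_const 6 * (fps_X ^ 4 * trib_fps ^ 3) + fps_const 12 * (fps_X ^ 2 * trib_fps ^ 3)
      + fps_const 6 * (fps_X ^ 1 * trib_fps ^ 3) + fps_const 2 * trib_fps ^ 3) $ n"
    unfolding trib_fps_second_deriv by (simp add: algebra_simps flip: numeral_fps_const)
  \<comment> \<open>The shift rule yields 0 when \<open>n < k\<close>; \<open>n \<ge> 5\<close>
    excludes this for every exponent present.\<close>
  also have "\<dots> =
      int (6 * S (n - 5) + 6 * S (n - 4) + 12 * S (n - 2) + 6 * S (n - 1) + 2 * S n)"
    unfolding fps_add_nth fps_mult_left_const_nth fps_X_power_mult_nth cube
    using assms by simp
  finally show ?thesis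
    unfolding S_def of_nat_eq_iff .
qed

end
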